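(* Let $n\geq 2$ and let $f=1^{x_{1}}0^{y_{1}}1^{x_{2}}0^{y_{2}}\cdots 1^{x_{n}}0^{y_{n}}$ with integers $x_i\geq 1$, $y_i\geq 1$ for $i=1,\ldots,n$. If $x_{1}=1$ and $y_{n}\geq y_{1}+2$, then $Q_{d}(f)\not\hookrightarrow Q_{d}$ for all $d\geq 2\sum_{i=2}^{n}(x_{i}+y_{i})+y_{1}$.
   Context: All strings are binary; $1^a$ (resp. $0^a$) denotes the string of $a$ consecutive ones (resp. zeros), and juxtaposition is concatenation. $Q_d$ is the $d$-dimensional hypercube: its vertices are the binary strings of length $d$, two being adjacent iff they differ in exactly one bit. A string $f$ is a factor of $\mu$ if $f$ appears as $|f|$ consecutive bits of $\mu$. The generalized Fibonacci cube $Q_d(f)$ is the subgraph of $Q_d$ induced by all strings of length $d$ that do not contain $f$ as a factor. A subgraph $H$ of a connected graph $G$ is an isometric subgraph, written $H\hookrightarrow G$ (and $H\not\hookrightarrow G$ otherwise), if $d_H(\mu,\nu)=d_G(\mu,\nu)$ for all $\mu,\nu\in V(H)$ (with $d_H=\infty$ for vertices in different components of $H$). *)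

theory Defs
  imports
    "HOL-Library.Sublist"
    "Graph_Theory.Digraph_Component"
    "Graph_Theory.Shortest_Path"
begin

text \<open>
  Binary strings are Boolean lists, with \<^const>\<open>True\<close> for the bit 1 and \<^const>\<open>False\<close> for the
  bit 0. ``\<open>f\<close> is a factor of \<open>w\<close>'' is \<open>sublist f w\<close>, which asks for a contiguous occurrence.
  Undirected graphs are symmetric digraphs, as usual in \<open>Graph_Theory\<close>.
\<close>

type_synonym bitstring = "bool list"

definition hypercube :: "nat \<Rightarrow> bitstring pair_pre_digraph" where
  "hypercube d =
    \<lparr> pverts = {w. length w = d},
      parcs = {(u, v). length u = d \<and> length v = d \<and> card {i. i < d \<and> u ! i \<noteq> v ! i} = 1} \<rparr>"

definition gen_fib_cube :: "nat \<Rightarrow> bitstring \<Rightarrow> (bitstring, bitstring \<times> bitstring) pre_digraph" where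
  "gen_fib_cube d f = with_proj (hypercube d) \<restriction> {w. length w = d \<and> \<not> sublist f w}"

text \<open>
  The shortest-path distance of the library with all edge weights equal to 1; it is \<open>\<infinity>\<close>
  for vertices in different components.
\<close>

definition graph_dist :: "('a, 'b) pre_digraph \<Rightarrow> 'a \<Rightarrow> 'a \<Rightarrow> ereal" where
  "graph_dist G u v = wf_digraph.\<mu> G (\<lambda>_. 1) u v"

definition isometric_subgraph :: "('a, 'b) pre_digraph \<Rightarrow> ('a, 'b) pre_digraph \<Rightarrow> bool" where
  "isometric_subgraph H G \<longleftrightarrow>
    subgraph H G \<and> (\<forall>u \<in> verts H. \<forall>v \<in> verts H. graph_dist H u v = graph_dist G u v)"

text \<open>The string $1^{x_1} 0^{y_1} 1^{x_2} 0^{y_2} \cdots 1^{x_n} 0^{y_n}$.\<close>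

definition block_string :: "nat \<Rightarrow> (nat \<Rightarrow> nat) \<Rightarrow> (nat \<Rightarrow> nat) \<Rightarrow> bitstring" where
  "block_string n x y = concat (map (\<lambda>i. replicate (x i) True @ replicate (y i) False) [1..<Suc n])"

text \<open>
  The hypercube is a connected simple graph and \<open>gen_fib_cube d f\<close> is an induced subgraph of it,
  so \<^const>\<open>isometric_subgraph\<close> can only fail for this pair because of the distances.
\<close>

lemma pair_graph_hypercube: "pair_graph (hypercube d)"
proof -
  have fin: "finite {w :: bitstring. length w = d}"
    using finite_lists_length_eq[of "UNIV :: bool set" d] by simp
  have "parcs (hypercube d) \<subseteq> {w. length w = d} \<times> {w. length w = d}"
    by (auto simp: hypercube_def)
  then have fin_arcs: "finite (parcs (hypercube d))"
    using fin finite_subset by blast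
  have swap: "{i. i < d \<and> u ! i \<noteq> v ! i} = {i. i < d \<and> v ! i \<noteq> u ! i}" for u v :: bitstring
    by auto
  have "(v, u) \<in> parcs (hypercube d)" if "(u, v) \<in> parcs (hypercube d)" for u v
    using that unfolding hypercube_def pair_pre_digraph.simps mem_Collect_eq prod.case swap[of u v]
    by blast
  then have "symmetric (with_proj (hypercube d))"
    by (auto simp: symmetric_def intro: symI)
  moreover have "fst e \<in> pverts (hypercube d)" "snd e \<in> pverts (hypercube d)" "fst e \<noteq> snd e"
    if "e \<in> parcs (hypercube d)" for e
    using that by (cases e; force simp: hypercube_def)+
  moreover have "finite (pverts (hypercube d))"
    using fin by (simp add: hypercube_def)
  ultimately show ?thesis
    using fin_arcs by unfold_locales
qed

lemma induced_subgraph_gen_fib_cube: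
  "induced_subgraph (gen_fib_cube d f) (with_proj (hypercube d))"
proof -
  interpret pair_graph "hypercube d" by (rule pair_graph_hypercube)
  have "{w. length w = d \<and> \<not> sublist f w} \<subseteq> verts (with_proj (hypercube d))"
    by (auto simp: hypercube_def)
  then show ?thesis
    unfolding gen_fib_cube_def using wf_digraph.induced_induce wf_digraph by blast
qed

lemma isometric_gen_fib_cube_iff:
  "isometric_subgraph (gen_fib_cube d f) (with_proj (hypercube d)) \<longleftrightarrow>
    (\<forall>u \<in> verts (gen_fib_cube d f). \<forall>v \<in> verts (gen_fib_cube d f).
      graph_dist (gen_fib_cube d f) u v = graph_dist (with_proj (hypercube d)) u v)"
  using induced_subgraph_gen_fib_cube[of d f]
  by (auto simp: isometric_subgraph_def induced_subgraph_def)

lemma hypercube_reachable: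
  assumes "length u = d" "length v = d"
  shows "u \<rightarrow>\<^sup>*\<^bsub>with_proj (hypercube d)\<^esub> v"
  using assms
proof (induction "card {i. i < d \<and> u ! i \<noteq> v ! i}" arbitrary: u)
  case 0
  then have "u = v" by (auto intro: nth_equalityI)
  interpret pair_graph "hypercube d" by (rule pair_graph_hypercube)
  show ?case using 0 \<open>u = v\<close> by (auto simp: reachable_def hypercube_def)
next
  case (Suc k)
  then obtain i where i: "i < d" "u ! i \<noteq> v ! i"
    by (metis (mono_tags, lifting) card.empty empty_Collect_eq nat.distinct(1))
  define u' where "u' = u[i := v ! i]"
  have len: "length u' = d" using Suc by (simp add: u'_def)
  have "{j. j < d \<and> u' ! j \<noteq> v ! j} = {j. j < d \<and> u ! j \<noteq> v ! j} - {i}"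
    using Suc i by (auto simp: u'_def nth_list_update)
  then have "k = card {j. j < d \<and> u' ! j \<noteq> v ! j}"
    using Suc(2) i by simp
  then have reach: "u' \<rightarrow>\<^sup>*\<^bsub>with_proj (hypercube d)\<^esub> v"
    using Suc len by blast
  have "{j. j < d \<and> u ! j \<noteq> u' ! j} = {i}"
    using Suc i by (auto simp: u'_def nth_list_update)
  then have "(u, u') \<in> parcs (hypercube d)"
    using Suc len by (simp add: hypercube_def)
  moreover have "u \<in> pverts (hypercube d)"
    using Suc by (simp add: hypercube_def)
  ultimately show ?case
    using reach unfolding reachable_def by (simp add: converse_rtrancl_on_into_rtrancl_on)
qed

lemma connected_hypercube: "Digraph_Component.connected (with_proj (hypercube d))"
proof -
  interpret pair_graph "hypercube d" by (rule pair_graph_hypercube)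
  have verts: "verts (with_proj (hypercube d)) = {w. length w = d}"
    by (simp add: hypercube_def)
  have "replicate d False \<in> {w. length w = d}"
    by simp
  then have "strongly_connected (with_proj (hypercube d))"
    unfolding strongly_connected_def verts using hypercube_reachable by blast
  then show ?thesis
    unfolding Digraph_Component.connected_def strongly_connected_def
    using reachable_mk_symmetricI by simp
qed

end

theory Submission
  imports Defs
begin

text \<open>
  Let \<open>a = y\<^sub>1\<close> and write \<open>f = 10\<^sup>a1v = u0\<^sup>a00\<close>. Two copies of \<open>f\<close> overlapping in \<open>a + 2\<close> bits
  disagree in exactly two places of the overlap, so \<open>\<mu> = u10\<^sup>a0v\<close> and \<open>\<nu> = u00\<^sup>a1v\<close> are at
  distance 2 while both words between them contain \<open>f\<close>. Neither \<open>\<mu>\<close> nor \<open>\<nu>\<close> contains \<open>f\<close>, except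
  that \<open>\<mu>\<close> does if \<open>f = 10\<^sup>a1z\<close> with \<open>z\<close> consisting of \<open>2a + 2\<close> zeros. In that case
  the second copy of \<open>f\<close> is shifted by \<open>a + 2\<close> instead, giving the words \<open>10\<^sup>a110\<^sup>a0z\<close> and
  \<open>10\<^sup>a100\<^sup>a1z\<close>. As \<open>f\<close> ends in 0, appending ones to reach length \<open>d\<close> creates no new occurrence.
\<close>

section \<open>Arcs of the cube and bounds on distances\<close>

lemma hypercube_arc_iff:
  "(u, v) \<in> parcs (hypercube d) \<longleftrightarrow> length u = d \<and> (\<exists>i<d. v = u[i := \<not> u ! i])"
proof
  assume "(u, v) \<in> parcs (hypercube d)"
  then have len: "length u = d" "length v = d" and "card {i. i < d \<and> u ! i \<noteq> v ! i} = 1"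
    by (auto simp: hypercube_def)
  then obtain i where i: "{i. i < d \<and> u ! i \<noteq> v ! i} = {i}"
    by (meson card_1_singletonE)
  have *: "j < d \<Longrightarrow> u ! j = v ! j \<longleftrightarrow> j \<noteq> i" for j
    using i by blast
  have "v = u[i := \<not> u ! i]"
  proof (rule nth_equalityI)
    fix j assume "j < length v"
    then show "v ! j = u[i := \<not> u ! i] ! j"
      using *[of j] len by (cases "j = i") auto
  qed (simp add: len)
  then show "length u = d \<and> (\<exists>i<d. v = u[i := \<not> u ! i])"
    using len i by blast
next
  assume "length u = d \<and> (\<exists>i<d. v = u[i := \<not> u ! i])"
  then obtain i where i: "length u = d" "i < d" "v = u[i := \<not> u ! i]"
    by blast
  then have "{j. j < d \<and> u ! j \<noteq> v ! j} = {i}"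
    by (auto simp: nth_list_update)
  then show "(u, v) \<in> parcs (hypercube d)"
    using i by (simp add: hypercube_def)
qed

lemma (in wf_digraph) awalk_cost_one: "awalk_cost (\<lambda>_. 1) p = real (length p)"
  by (induction p) auto

lemma (in wf_digraph) graph_dist_le_iff:
  "graph_dist G u v \<le> ereal (real k) \<longleftrightarrow> (\<exists>p. awalk u p v \<and> length p \<le> k)"
proof
  assume "graph_dist G u v \<le> ereal (real k)"
  \<comment> \<open>A strict bound lets the infimum yield an actual walk; its cost is an integer, so
    below \<open>Suc k\<close> still means at most k.\<close>
  also have "ereal (real k) < ereal (real (Suc k))"
    by simp
  finally obtain p where "awalk u p v" "ereal (awalk_cost (\<lambda>_. 1) p) < ereal (real (Suc k))"
    unfolding graph_dist_def \<mu>_def INF_less_iff by blast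
  then show "\<exists>p. awalk u p v \<and> length p \<le> k"
    by (auto simp: awalk_cost_one)
next
  assume "\<exists>p. awalk u p v \<and> length p \<le> k"
  then obtain p where p: "awalk u p v" "length p \<le> k"
    by blast
  have "graph_dist G u v \<le> ereal (awalk_cost (\<lambda>_. 1) p)"
    unfolding graph_dist_def using p(1) by (rule min_cost_le_walk_cost)
  also have "\<dots> \<le> ereal (real k)"
    using p(2) by (simp add: awalk_cost_one)
  finally show "graph_dist G u v \<le> ereal (real k)" .
qed

section \<open>Pairs of words differing in two bits\<close>

text \<open>Bits p and q both change, and only the flips at i and j can change them, so
  \<open>{p, q}\<close> lies in \<open>{i, j}\<close> and the first flip is at p or q.\<close>

lemma list_update_twice_midpoint:
  fixes u :: bitstring
  assumes "i < length u" "j < length u" "p < length u" "q < length u" "p \<noteq> q"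
    and w: "w = u[i := \<not> u ! i]"
    and v: "u[p := \<not> u ! p, q := \<not> u ! q] = w[j := \<not> w ! j]"
  shows "w = u[p := \<not> u ! p] \<or> w = u[q := \<not> u ! q]"
proof -
  have "k \<in> {i, j}" if "k \<in> {p, q}" for k
  proof (rule ccontr)
    assume k: "k \<notin> {i, j}"
    have "u[p := \<not> u ! p, q := \<not> u ! q] ! k = (\<not> u ! k)"
      using that assms(3-5) by (auto simp: nth_list_update)
    moreover have "w[j := \<not> w ! j] ! k = u ! k"
      using k w by auto
    ultimately show False
      using v by simp
  qed
  then have "i = p \<or> i = q"
    using \<open>p \<noteq> q\<close> by blast
  then show ?thesis
    using w by blast
qed

text \<open>Flipping p, then q, is a walk of length 2 in the cube. In the subgraph, the midpoint of
  such a walk would be a word excluded by \<open>fp\<close> or \<open>fq\<close>, and a shorter walk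
  cannot change two bits.\<close>

lemma critical_pair_not_isometric:
  fixes u :: bitstring
  assumes len: "length u = d" and pq: "p < d" "q < d" "p \<noteq> q"
    and u: "\<not> sublist f u"
    and v: "\<not> sublist f (u[p := \<not> u ! p, q := \<not> u ! q])"
    and fp: "sublist f (u[p := \<not> u ! p])"
    and fq: "sublist f (u[q := \<not> u ! q])"
  shows "\<not> isometric_subgraph (gen_fib_cube d f) (with_proj (hypercube d))"
proof
  let ?Q = "with_proj (hypercube d)" and ?H = "gen_fib_cube d f"
  define v where "v = u[p := \<not> u ! p, q := \<not> u ! q]"
  assume iso: "isometric_subgraph ?H ?Q"
  interpret Q: pair_graph "hypercube d" by (rule pair_graph_hypercube)
  interpret H: wf_digraph ?H
    unfolding gen_fib_cube_def using Q.wellformed_induce_subgraph by blast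
  have vH: "verts ?H = {w. length w = d \<and> \<not> sublist f w}"
    by (simp add: gen_fib_cube_def)
  have arcH: "(s, t) \<in> parcs (hypercube d)" "tail ?H (s, t) = s" "head ?H (s, t) = t"
    if "(s, t) \<in> arcs ?H" for s t
    using that by (auto simp: gen_fib_cube_def)
  let ?m = "u[p := \<not> u ! p]"
  have "(u, ?m) \<in> parcs (hypercube d)" "(?m, v) \<in> parcs (hypercube d)"
    unfolding hypercube_arc_iff v_def using len pq by auto
  then have "Q.awalk u [(u, ?m), (?m, v)] v"
    using len by (simp add: Q.awalk_simps) (simp add: hypercube_def v_def)
  then have "graph_dist ?Q u v \<le> ereal (real 2)"
    using Q.graph_dist_le_iff[of u v 2] by force
  moreover have "u \<in> verts ?H" "v \<in> verts ?H"
    using assms by (auto simp: vH v_def)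
  ultimately have "graph_dist ?H u v \<le> ereal (real 2)"
    using iso by (simp add: isometric_subgraph_def)
  then obtain es where es: "H.awalk u es v" "length es \<le> 2"
    unfolding H.graph_dist_le_iff by blast
  have up: "v ! p \<noteq> u ! p" "v ! q \<noteq> u ! q"
    using len pq by (auto simp: v_def nth_list_update)
  consider "es = []" | e where "es = [e]" | e e' where "es = [e, e']"
    using es(2) by (cases es; cases "tl es") auto
  then show False
  proof cases
    case 1
    then show False
      using es(1) up by (auto simp: H.awalk_simps)
  next
    case 2
    then have "(u, v) \<in> parcs (hypercube d)"
      using es(1) arcH by (cases e) (auto simp: H.awalk_simps)
    then show False
      using up \<open>p \<noteq> q\<close> unfolding hypercube_arc_iff by (metis nth_list_update_neq)
  next
    case 3
    then obtain w where w: "(u, w) \<in> parcs (hypercube d)" "(w, v) \<in> parcs (hypercube d)"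
      "w \<in> verts ?H"
    proof -
      obtain s w where e: "e = (s, w)"
        by (cases e)
      obtain s' t' where e': "e' = (s', t')"
        by (cases e')
      have arcs: "(s, w) \<in> arcs ?H" "(s', t') \<in> arcs ?H"
        and "u = s" "w = s'" "t' = v"
        using es(1) arcH unfolding 3 e e' H.awalk_simps by metis+
      then show thesis
        using that[of w] arcH(1) arcH(3)[of s w] H.head_in_verts[of "(s, w)"] by simp
    qed
    then obtain i j where "i < d" "j < d" "w = u[i := \<not> u ! i]" "v = w[j := \<not> w ! j]"
      by (auto simp: hypercube_arc_iff)
    then have "w = ?m \<or> w = u[q := \<not> u ! q]"
      using list_update_twice_midpoint len pq unfolding v_def by metis
    then show False
      using w(3) fp fq by (auto simp: vH)
  qed
qed

lemma critical_words_not_isometric: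
  fixes P M Q :: bitstring
  assumes "length P + length M + length Q + 2 = d"
    and "\<not> sublist f (P @ True # M @ False # Q)"
    and "\<not> sublist f (P @ False # M @ True # Q)"
    and "sublist f (P @ False # M @ False # Q)"
    and "sublist f (P @ True # M @ True # Q)"
  shows "\<not> isometric_subgraph (gen_fib_cube d f) (with_proj (hypercube d))"
proof -
  let ?u = "P @ True # M @ False # Q" and ?p = "length P" and ?q = "length P + Suc (length M)"
  have "?u ! ?p" "\<not> ?u ! ?q"
    by (simp_all add: nth_append)
  moreover have "?u[?p := b] = P @ b # M @ False # Q" "?u[?q := b] = P @ True # M @ b # Q"
    "(P @ b # M @ False # Q)[?q := c] = P @ b # M @ c # Q" for b c
    by (simp_all add: list_update_append)
  ultimately show ?thesis
    using assms critical_pair_not_isometric[of ?u d ?p ?q f] by simp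
qed

section \<open>Padding and periodicity of words\<close>

text \<open>An occurrence reaching into the padding would end in c.\<close>

lemma sublist_append_replicateD:
  assumes "sublist f (w @ replicate k c)" "f \<noteq> []" "last f \<noteq> c"
  shows "sublist f w"
  using assms(1)
proof (induction k)
  case (Suc k)
  have "w @ replicate (Suc k) c = (w @ replicate k c) @ [c]"
    by (simp add: replicate_append_same)
  then have "suffix f ((w @ replicate k c) @ [c]) \<or> sublist f (w @ replicate k c)"
    using Suc.prems sublist_snoc by metis
  moreover have "\<not> suffix f ((w @ replicate k c) @ [c])"
    using assms(2,3) by (auto simp only: suffix_snoc last_snoc append_is_Nil_conv)
  ultimately show ?case
    using Suc.IH by blast
qed simp

text \<open>Letter i is c for i < k and otherwise equals the earlier letter i - k.\<close>

lemma prefix_replicate_append_self: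
  assumes "prefix xs (replicate k c @ xs)" "k \<ge> 1"
  shows "xs = replicate (length xs) c"
proof -
  have "xs ! i = c" if "i < length xs" for i
    using that
  proof (induction i rule: less_induct)
    case (less i)
    have "xs ! i = (replicate k c @ xs) ! i"
      using assms(1) less.prems by (metis nth_append prefix_def)
    also have "\<dots> = c"
      using less assms(2) by (auto simp: nth_append)
    finally show ?case .
  qed
  then show ?thesis
    by (intro nth_equalityI) auto
qed

section \<open>Occurrences of f in the overlap words\<close>

text \<open>The whole word exceeds f by \<open>length u\<close> letters, so an occurrence starts at
  most that far in and covers all of m; what it leaves out of u it takes from v.\<close>

lemma sublist_overlapE:
  assumes "sublist f (u @ m @ v)" "length f = length u + length m" "length v = length u"
  obtains p u2 v1 s where "u = p @ u2" "v = v1 @ s" "f = u2 @ m @ v1" "length v1 = length p"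
proof -
  obtain p s where e: "u @ m @ v = p @ f @ s"
    using assms(1) by (auto simp: sublist_def)
  have "length (u @ m @ v) = length (p @ f @ s)"
    by (simp add: e)
  then have l: "length p + length s = length u"
    using assms by simp
  have u: "u = p @ drop (length p) u"
    using arg_cong[OF e, of "take (length p)"] l
    by simp (metis append_take_drop_id)
  have v: "v = take (length p) v @ s"
    using arg_cong[OF e, of "drop (length u + length m + length p)"] l assms
    by simp (metis append_take_drop_id)
  have "p @ drop (length p) u @ m @ take (length p) v @ s = p @ f @ s"
    using e u v by (metis append.assoc)
  then show thesis
    using that[OF u v] l assms(3) by simp
qed

text \<open>
  If \<open>u2\<close> had length at least \<open>a + 2\<close>, then \<open>10\<^sup>a1 v1 = p 10\<^sup>a1\<close>, so \<open>p\<close> and \<open>v1\<close> would contain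
  equally many ones; but counting ones in \<open>f = p u2 0\<^sup>a00 = u2 m v1\<close> shows that \<open>p\<close> has one more.
\<close>

lemma overlap_start:
  assumes f1: "f = True # replicate a False @ True # v"
    and f2: "f = u @ replicate (a + 2) False"
    and m: "count_list m True = 1" "length m = a + 2"
    and u: "u = p @ u2" and v: "v = v1 @ s" and f: "f = u2 @ m @ v1" and p: "length v1 = length p"
  shows "u2 = [] \<or> (\<exists>k\<le>a. u2 = True # replicate k False)"
proof -
  let ?h = "True # replicate a False @ [True]"
  have c0: "count_list (replicate k False) True = 0" for k
    by (induction k) auto
  have ch: "count_list ?h True = 2"
    by (simp add: c0)
  have "count_list (u2 @ m @ v1) True = count_list (p @ u2 @ replicate (a + 2) False) True"
    using f f2 u by (simp only: append.assoc)
  then have cp: "count_list p True = 1 + count_list v1 True"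
    using m c0[of "a + 2"] by (simp del: replicate_Suc add: add_2_eq_Suc')
  have e: "?h @ v1 @ s = p @ u2 @ replicate (a + 2) False"
    using f1 f2 u v by simp
  have short: "length u2 < a + 2"
  proof (rule ccontr)
    assume "\<not> length u2 < a + 2"
    then have "take (a + 2) u2 = take (a + 2) f"
      using f by simp
    also have "\<dots> = ?h"
      using f1 by simp
    finally obtain t where t: "u2 = ?h @ t"
      by (metis append_take_drop_id)
    have "(?h @ v1) @ s = (p @ ?h) @ t @ replicate (a + 2) False"
      using e t by simp
    moreover have "length (?h @ v1) = length (p @ ?h)"
      using p by simp
    ultimately have "?h @ v1 = p @ ?h"
      using append_eq_append_conv by blast
    then have "count_list (?h @ v1) True = count_list (p @ ?h) True"
      by (rule arg_cong)
    then show False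
      using cp by (simp add: c0)
  qed
  \<comment> \<open>As a prefix of f with fewer than a + 2 letters, \<open>u2\<close> lies within
    10^a.\<close>
  have "u2 = take (length u2) (?h @ v)"
    using f f1 by (metis append_eq_conv_conj append.assoc append_Cons append_Nil)
  also have "\<dots> = take (length u2) (True # replicate a False)"
    using short by (simp add: take_Cons')
  finally show ?thesis
    using short by (cases "length u2") auto
qed

lemma nth_block:
  assumes "f = True # replicate a False @ True # v"
  shows "i \<le> a + 1 \<Longrightarrow> f ! i \<longleftrightarrow> i = 0 \<or> i = a + 1"
  using assms by (auto simp: nth_Cons nth_append split: nat.splits)

text \<open>An occurrence would be f = u2 00^a1 v1. If u2 is empty, f starts with 0; if u2 = 10^k,
  the first block of zeros in f is longer than a.\<close>

lemma not_sublist_overlap_01: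
  assumes f1: "f = True # replicate a False @ True # v"
    and f2: "f = u @ replicate (a + 2) False"
  shows "\<not> sublist f (u @ False # replicate a False @ True # v)"
proof
  let ?m = "False # replicate a False @ [True]"
  assume "sublist f (u @ False # replicate a False @ True # v)"
  then have "sublist f (u @ ?m @ v)"
    by simp
  moreover have "length f = length u + length ?m" "length v = length u"
    using f2 arg_cong[OF f1, of length] by simp_all
  ultimately obtain p u2 v1 s where *: "u = p @ u2" "v = v1 @ s" "f = u2 @ ?m @ v1"
    "length v1 = length p"
    by (rule sublist_overlapE)
  have "count_list ?m True = 1"
    by (induction a) auto
  then have "u2 = [] \<or> (\<exists>k\<le>a. u2 = True # replicate k False)"
    using overlap_start[OF f1 f2 _ _ *] by simp
  moreover have "u2 \<noteq> []"
    using nth_block[OF f1, of 0] *(3) by auto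
  ultimately obtain k where k: "k \<le> a" "u2 = True # replicate k False"
    by blast
  have "\<not> f ! (a + 1)"
    using k *(3) by (auto simp: nth_append nth_Cons split: nat.splits)
  then show False
    using nth_block[OF f1, of "a + 1"] by simp
qed

text \<open>Here the one opening \<open>?m\<close> must be the second one of f, so u2 = 10^a. Then v
  = 0^(a+1) v1 with v1 a prefix of v, which forces v to be all zeros and leaves only the word in
  \<open>ne\<close>.\<close>

lemma not_sublist_overlap_10:
  assumes f1: "f = True # replicate a False @ True # v"
    and f2: "f = u @ replicate (a + 2) False"
    and ne: "f \<noteq> True # replicate a False @ True # replicate (2 * a + 2) False"
  shows "\<not> sublist f (u @ True # replicate a False @ False # v)"
proof
  let ?m = "True # replicate a False @ [False]"
  assume "sublist f (u @ True # replicate a False @ False # v)"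
  then have "sublist f (u @ ?m @ v)"
    by simp
  moreover have "length f = length u + length ?m" "length v = length u"
    using f2 arg_cong[OF f1, of length] by simp_all
  ultimately obtain p u2 v1 s where *: "u = p @ u2" "v = v1 @ s" "f = u2 @ ?m @ v1"
    "length v1 = length p"
    by (rule sublist_overlapE)
  have "count_list ?m True = 1"
    by (induction a) auto
  then have "u2 = [] \<or> (\<exists>k\<le>a. u2 = True # replicate k False)"
    using overlap_start[OF f1 f2 _ _ *] by simp
  moreover have "u2 \<noteq> []"
    using nth_block[OF f1, of "a + 1"] *(3) by (auto simp: nth_append)
  ultimately obtain k where k: "k \<le> a" "u2 = True # replicate k False"
    by blast
  have "f ! (k + 1)"
    using k *(3) by (auto simp: nth_append)
  then have u2: "u2 = True # replicate a False"
    using nth_block[OF f1, of "k + 1"] k by simp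
  then have v: "v = replicate (a + 1) False @ v1"
    using *(3) f1 by (simp add: replicate_append_same)
  then have "prefix v1 (replicate (a + 1) False @ v1)"
    using *(2) by (metis prefixI)
  then have "v1 = replicate (length v1) False"
    by (rule prefix_replicate_append_self) simp
  then obtain q where q: "v = replicate q False"
    using v by (metis replicate_add)
  \<comment> \<open>The trailing zeros of f are counted twice: q of them after 10^a1, and a + (a +
    2) after the one that opens \<open>u2\<close>.\<close>
  have "takeWhile Not (rev f) = replicate q False"
    using f1 q by (simp add: takeWhile_append)
  moreover have "f = p @ True # replicate (2 * a + 2) False"
  proof -
    have "2 * a + 2 = a + (a + 2)"
      by simp
    then have "replicate (2 * a + 2) False = replicate a False @ replicate (a + 2) False"
      by (simp only: replicate_add)
    then show ?thesis
      using f2 *(1) u2 by simp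
  qed
  then have "takeWhile Not (rev f) = replicate (2 * a + 2) False"
    by (simp add: takeWhile_append del: replicate_Suc)
  ultimately show False
    using f1 q ne by simp
qed

section \<open>The exceptional word\<close>

text \<open>The two ones of f are a + 1 apart. In either long word only the ones at 0 and a + 1 are,
  so an occurrence starts at 0, where the third one of the long word meets a zero of f.\<close>

lemma not_sublist_exceptional:
  fixes a :: nat
  defines "f \<equiv> True # replicate a False @ True # replicate (2 * a + 2) False"
  assumes a: "a \<ge> 1"
  shows "\<not> sublist f ((True # replicate a False @ [True]) @
           True # replicate a False @ False # replicate (2 * a + 2) False)" (is "\<not> sublist f ?u")
    and "\<not> sublist f ((True # replicate a False @ [True]) @
           False # replicate a False @ True # replicate (2 * a + 2) False)" (is "\<not> sublist f ?v")
proof -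
  have u: "?u ! i \<longleftrightarrow> i \<in> {0, a + 1, a + 2}" if "i < 4 * a + 6" for i
    using that by (auto simp: nth_Cons nth_append split: nat.splits)
  have v: "?v ! i \<longleftrightarrow> i \<in> {0, a + 1, 2 * a + 3}" if "i < 4 * a + 6" for i
    using that by (auto simp: nth_Cons nth_append split: nat.splits)
  have f: "f ! i \<longleftrightarrow> i \<in> {0, a + 1}" if "i < 3 * a + 4" for i
    using that by (auto simp: f_def nth_Cons nth_append split: nat.splits)
  have lf: "length f = 3 * a + 4"
    by (simp add: f_def)
  have occ: "\<exists>p\<le>a + 2. \<forall>i<3 * a + 4. w ! (p + i) \<longleftrightarrow> i \<in> {0, a + 1}"
    if occurs: "sublist f w" and lw: "length w = 4 * a + 6" for w
  proof -
    obtain p s where w: "w = p @ f @ s"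
      using occurs unfolding sublist_def by blast
    have "w ! (length p + i) = f ! i" if "i < 3 * a + 4" for i
      using that lf by (simp add: w nth_append)
    moreover have "length p \<le> a + 2"
      using lw lf w by simp
    ultimately show ?thesis
      using f by blast
  qed
  show "\<not> sublist f ?u"
  proof
    assume "sublist f ?u"
    moreover have "length ?u = 4 * a + 6"
      by simp
    ultimately obtain p where p: "p \<le> a + 2" "\<And>i. i < 3 * a + 4 \<Longrightarrow> ?u ! (p + i) \<longleftrightarrow> i \<in> {0, a + 1}"
      using occ by blast
    have "p \<in> {0, a + 1, a + 2}" "p + (a + 1) \<in> {0, a + 1, a + 2}"
      "p + (a + 2) \<notin> {0, a + 1, a + 2}"
      using p(1) p(2)[of 0] p(2)[of "a + 1"] p(2)[of "a + 2"]
        u[of p] u[of "p + (a + 1)"] u[of "p + (a + 2)"] by simp_all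
    \<comment> \<open>a >= 1 keeps the adjacent ones at a + 1 and a + 2 from being a + 1
      apart.\<close>
    then show False
      using a by auto
  qed
  show "\<not> sublist f ?v"
  proof
    assume "sublist f ?v"
    moreover have "length ?v = 4 * a + 6"
      by simp
    ultimately obtain p where p: "p \<le> a + 2" "\<And>i. i < 3 * a + 4 \<Longrightarrow> ?v ! (p + i) \<longleftrightarrow> i \<in> {0, a + 1}"
      using occ by blast
    have "p \<in> {0, a + 1, 2 * a + 3}" "p + (a + 1) \<in> {0, a + 1, 2 * a + 3}"
      "p + (2 * a + 3) \<notin> {0, a + 1, 2 * a + 3}"
      using p(1) p(2)[of 0] p(2)[of "a + 1"] p(2)[of "2 * a + 3"]
        v[of p] v[of "p + (a + 1)"] v[of "p + (2 * a + 3)"] by simp_all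
    then show False
      by auto
  qed
qed

section \<open>Padding to length d and the two cases\<close>

text \<open>As u and v are equally long, the bound on d is the length of the overlap words.\<close>

lemma not_isometric_of_overlap:
  assumes f1: "f = True # replicate a False @ True # v"
    and f2: "f = u @ replicate (a + 2) False"
    and a: "a \<ge> 1" and d: "d \<ge> 2 * length v + a + 2"
  shows "\<not> isometric_subgraph (gen_fib_cube d f) (with_proj (hypercube d))"
proof -
  have len: "length v = length u"
    using f2 arg_cong[OF f1, of length] by simp
  have zeros: "False # replicate a False @ False # w = replicate (a + 2) False @ w" for w
    by (simp add: replicate_app_Cons_same)
  have pad: "\<not> sublist f (w @ replicate k True)" if "\<not> sublist f w" for w k
  proof -
    have "last f = False" "f \<noteq> []"
      unfolding f2 by simp_all
    then show ?thesis
      using that sublist_append_replicateD[of f w k True] by blast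
  qed
  have crit: "\<not> isometric_subgraph (gen_fib_cube d f) (with_proj (hypercube d))"
    if "length P + length M + length Q + 2 \<le> d"
      "\<not> sublist f (P @ True # M @ False # Q)"
      "\<not> sublist f (P @ False # M @ True # Q)"
      "sublist f (P @ False # M @ False # Q)"
      "sublist f (P @ True # M @ True # Q)" for P M Q
  proof -
    define R where "R = replicate (d - (length P + length M + length Q + 2)) True"
    have ext: "sublist f (w @ R)" if "sublist f w" for w
      using that by (metis append.assoc sublist_def)
    show ?thesis
      using critical_words_not_isometric[of P M "Q @ R" d f] that
        pad[OF that(2)] pad[OF that(3)] ext[OF that(4)] ext[OF that(5)]
      by (simp add: R_def)
  qed
  show ?thesis
  proof (cases "f = True # replicate a False @ True # replicate (2 * a + 2) False")
    case False
    have "u @ False # replicate a False @ False # v = f @ v"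
      unfolding zeros f2 by simp
    then have "sublist f (u @ False # replicate a False @ False # v)"
      by (simp only: sublist_append_rightI)
    moreover have "sublist f (u @ True # replicate a False @ True # v)"
      unfolding f1 by blast
    ultimately show ?thesis
      using crit[of u "replicate a False" v] not_sublist_overlap_10[OF f1 f2 False]
        not_sublist_overlap_01[OF f1 f2] d len by simp
  next
    case True
    let ?h = "True # replicate a False @ [True]" and ?z = "replicate (2 * a + 2) False"
    \<comment> \<open>Of the 3a + 4 zeros after \<open>?h\<close>, f takes the first 2a + 2.\<close>
    have "?h @ False # replicate a False @ False # ?z = f @ replicate (a + 2) False"
      unfolding zeros True
      by (simp add: add.commute[of "a + 2"] del: replicate_Suc flip: replicate_add)
    then have "sublist f (?h @ False # replicate a False @ False # ?z)"
      by (simp only: sublist_append_rightI)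
    moreover have "sublist f (?h @ True # replicate a False @ True # ?z)"
      unfolding True by blast
    moreover have "length v = 2 * a + 2"
      using arg_cong[OF f1, of length] True by simp
    \<comment> \<open>The exceptional words have 4a + 6 letters, while the bound on d is 5a +
      6.\<close>
    then have "length ?h + length (replicate a False) + length ?z + 2 \<le> d"
      using d by simp
    ultimately show ?thesis
      using crit not_sublist_exceptional[OF a, folded True] by blast
  qed
qed

section \<open>From the block form to the two decompositions of f\<close>

theorem lemma2p2:
  fixes n d :: nat and x y :: "nat \<Rightarrow> nat" and f :: bitstring
  assumes "n \<ge> 2"
    and "\<forall>i \<in> {1..n}. x i \<ge> 1 \<and> y i \<ge> 1"
    and "f = block_string n x y"
    and "x 1 = 1"
    and "y n \<ge> y 1 + 2"
    and "d \<ge> 2 * (\<Sum>i = 2..n. x i + y i) + y 1"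
  shows "\<not> isometric_subgraph (gen_fib_cube d f) (with_proj (hypercube d))"
proof -
  let ?b = "\<lambda>i. replicate (x i) True @ replicate (y i) False"
  define g where "g = concat (map ?b [2..<Suc n])"
  have "[1..<Suc n] = 1 # [2..<Suc n]"
    using assms(1) by (simp add: upt_conv_Cons numeral_2_eq_2)
  then have f: "f = True # replicate (y 1) False @ g"
    using assms(3,4) by (simp add: block_string_def g_def)
  have "[2..<Suc n] = 2 # [3..<Suc n]"
    using assms(1) by (simp add: upt_conv_Cons)
  moreover have "x 2 \<ge> 1"
    using assms(1,2) by simp
  then have "replicate (x 2) True = True # replicate (x 2 - 1) True"
    by (cases "x 2") auto
  ultimately obtain v where v: "g = True # v"
    by (simp add: g_def)
  \<comment> \<open>The last block supplies the final \<open>y 1 + 2\<close> zeros; any surplus goes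
    into u.\<close>
  have "replicate (y n) False = replicate (y n - (y 1 + 2)) False @ replicate (y 1 + 2) False"
    using assms(5) by (simp flip: replicate_add del: replicate_Suc)
  moreover have "[1..<Suc n] = [1..<n] @ [n]"
    using assms(1) by simp
  ultimately obtain u where u: "f = u @ replicate (y 1 + 2) False"
    using assms(3) by (simp add: block_string_def)
  have "length g = (\<Sum>i = 2..n. x i + y i)"
    by (simp add: g_def length_concat comp_def sum_list_distinct_conv_sum_set
        atLeastLessThanSuc_atLeastAtMost del: upt_Suc)
  \<comment> \<open>The leading one of \<open>g\<close>, counted twice, gives the 2.\<close>
  then have "d \<ge> 2 * length v + y 1 + 2"
    using assms(6) v by simp
  moreover have "y 1 \<ge> 1"
    using assms(1,2) by simp
  ultimately show ?thesis
    using not_isometric_of_overlap u f v by blast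
qed

end
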